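(* Let $X=(X_t)_{t\ge0}$ be a Lévy process such that the characteristic function $\psi_1$ of $X_1$ is $C^\infty$ and $\int_{-\infty}^\infty|u|^m|\psi_1^{(r)}(u)|\,du<\infty$ for all integers $r,m\ge0$. Let $\gamma$ be the function such that $\psi_t(u):=\mathbb{E}e^{\mathrm{i}uX_t}=e^{t\gamma(u)}$, and let $p_t$ be the density of $X_t$. Suppose that, for some $0<\alpha\le2$: (1) for each integer $i\ge1$ there exist $c_i<\infty$ and $u_{0,i}>0$ such that $|\gamma^{(i)}(u)|\le c_i|u|^{\alpha-i}$ for all $|u|>u_{0,i}$; (2) there exist $u_0>0$ and $0<c_0<\infty$ such that $|\psi_1(u)|\le e^{-c_0|u|^\alpha}$ for all $u>u_0$. Then, for every integer $m\ge0$, every $\varepsilon>0$, and every $t_0>0$, $$\sup_{0<t\le t_0}\ \sup_{|x|>\varepsilon}\big|p_t^{(m)}(x)\big|<\infty .$$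
   Context: Here $\gamma$ is the (continuous) characteristic exponent of $X$ with $\gamma(0)=0$, $\mathrm{i}$ (upright) is the imaginary unit, and $p_t^{(m)}$ denotes the $m$-th derivative of the ($C^\infty$) density $p_t$ in $x$. *)

theory Defs
  imports "HOL-Probability.Probability"
begin

text \<open>
  Iterated derivative of a function on the real line. It is based on \<^const>\<open>vector_derivative\<close>
  because \<^const>\<open>deriv\<close> requires equal domain and codomain types, whereas characteristic
  functions and exponents are complex-valued functions of a real variable.
\<close>

definition nth_derivative :: "nat \<Rightarrow> (real \<Rightarrow> 'b::real_normed_vector) \<Rightarrow> real \<Rightarrow> 'b" where
  "nth_derivative n f = ((\<lambda>g x. vector_derivative g (at x)) ^^ n) f"

definition smooth :: "(real \<Rightarrow> 'b::real_normed_vector) \<Rightarrow> bool" where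
  "smooth f \<longleftrightarrow> (\<forall>n x. nth_derivative n f differentiable (at x))"

text \<open>
  Only the values \<open>X t\<close> with \<open>t \<ge> 0\<close> matter. Path regularity is required in the form of
  stochastic continuity; right-continuity of the paths is not assumed. The case \<open>t i = t (Suc i)\<close> in
  \<open>independent_increments\<close> is harmless, since that increment is constantly 0.
\<close>

locale levy_process = prob_space M for M :: "'a measure" +
  fixes X :: "real \<Rightarrow> 'a \<Rightarrow> real"
  assumes random_variable: "\<And>t. t \<ge> 0 \<Longrightarrow> random_variable borel (X t)"
    and initial: "AE \<omega> in M. X 0 \<omega> = 0"
    and independent_increments:
      "\<And>(n::nat) t. 0 \<le> t 0 \<Longrightarrow> (\<And>i. i < n \<Longrightarrow> t i \<le> t (Suc i)) \<Longrightarrow>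
        indep_vars (\<lambda>_. borel) (\<lambda>i \<omega>. X (t (Suc i)) \<omega> - X (t i) \<omega>) {..<n}"
    and stationary_increments:
      "\<And>s h. s \<ge> 0 \<Longrightarrow> h \<ge> 0 \<Longrightarrow>
        distr M borel (\<lambda>\<omega>. X (s + h) \<omega> - X s \<omega>) = distr M borel (X h)"
    and stochastically_continuous:
      "\<And>s \<epsilon>. s \<ge> 0 \<Longrightarrow> \<epsilon> > 0 \<Longrightarrow>
        ((\<lambda>t. prob {\<omega> \<in> space M. \<bar>X t \<omega> - X s \<omega>\<bar> > \<epsilon>}) \<longlongrightarrow> 0) (at s within {0..})"

definition characteristic_function :: "'a measure \<Rightarrow> (real \<Rightarrow> 'a \<Rightarrow> real) \<Rightarrow> real \<Rightarrow> real \<Rightarrow> complex" where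
  "characteristic_function M X t = char (distr M borel (X t))"

text \<open>
  The density of a real random variable is only determined almost everywhere; continuity selects
  the version. Under the integrability conditions used with this notion, that version is smooth,
  so that its iterated derivatives are the genuine ones. Nonnegativity must be stated since
  \<^const>\<open>ennreal\<close> truncates negative values to 0.
\<close>

definition continuous_density :: "'a measure \<Rightarrow> ('a \<Rightarrow> real) \<Rightarrow> (real \<Rightarrow> real) \<Rightarrow> bool" where
  "continuous_density M Y f \<longleftrightarrow>
    continuous_on UNIV f \<and> (\<forall>x. f x \<ge> 0) \<and> distributed M lborel Y (\<lambda>x. ennreal (f x))"

end

theory Submission
  imports Defs "HOL-Real_Asymp.Real_Asymp"
begin

text \<open>
  By Fourier inversion, the \<open>m\<close>-th derivative of \<open>p\<^sub>t\<close> at \<open>x\<close> is \<open>1/(2\<pi>)\<close> times the integral of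
  \<open>exp(-iux) (-iu)^m exp(t \<gamma>(u))\<close> over \<open>u\<close>. Integrating by parts \<open>m + 2\<close> times gains a factor
  \<open>\<bar>x\<bar>^-(m + 2)\<close>. Every \<open>u\<close>-derivative gains a factor \<open>1/(1 + \<bar>u\<bar>)\<close>: trivially on \<open>u^m\<close>, and
  on \<open>exp(t \<gamma>(u))\<close> at the price of a factor \<open>1 + t \<bar>u\<bar>^\<alpha>\<close>, because \<open>\<gamma>'(u) = O(\<bar>u\<bar>^(\<alpha> - 1))\<close>. Powers
  of \<open>1 + t \<bar>u\<bar>^\<alpha>\<close> are absorbed, uniformly in \<open>t\<close>, by \<open>\<bar>exp(t \<gamma>(u))\<bar> \<le> K exp(-c t \<bar>u\<bar>^\<alpha>)\<close>, so that
  \<open>O((1 + \<bar>u\<bar>)^-2)\<close> remains. Stating such estimates through a predicate closed under products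
  (\<open>symbol_bound\<close>) avoids explicit formulas for the higher derivatives of \<open>exp(t \<gamma>)\<close>.
\<close>

section \<open>Families with symbol-type derivative bounds\<close>

lemma nth_derivative_0 [simp]: "nth_derivative 0 f = f"
  by (simp add: nth_derivative_def)

lemma nth_derivative_Suc: "nth_derivative (Suc n) f x = vector_derivative (nth_derivative n f) (at x)"
  by (simp add: nth_derivative_def)

lemma nth_derivative_Suc_inner:
  assumes "\<And>x. (f has_vector_derivative f' x) (at x)"
  shows "nth_derivative (Suc n) f = nth_derivative n f'"
proof -
  have "(\<lambda>x. vector_derivative f (at x)) = f'"
    using assms by (auto intro: vector_derivative_at)
  then show ?thesis
    by (simp add: nth_derivative_def funpow_Suc_right del: funpow.simps)
qed

text \<open>Serves to identify all derivatives of a density at once, by exhibiting explicit Fourier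
  integrals as the successive derivatives.\<close>

lemma nth_derivative_unique:
  assumes "g 0 = f" and "\<And>n x. (g n has_vector_derivative g (Suc n) x) (at x)"
  shows "nth_derivative n f = g n"
proof (induction n)
  case (Suc n)
  then show ?case
    using assms(2)[of n] by (auto simp: nth_derivative_Suc intro!: ext vector_derivative_at)
qed (use assms in simp)

text \<open>Symbol classes as in pseudodifferential calculus, truncated at order \<open>n\<close>
  and for a family indexed by \<open>I\<close>. The constant \<open>C\<close> may depend on the
  order \<open>k\<close> but not on \<open>t\<close>; all dependence on \<open>t\<close> has to sit
  in the weight \<open>w\<close>.\<close>

definition symbol_bound ::
    "nat \<Rightarrow> 'i set \<Rightarrow> ('i \<Rightarrow> real \<Rightarrow> real) \<Rightarrow> ('i \<Rightarrow> real \<Rightarrow> complex) \<Rightarrow> bool" where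
  "symbol_bound n I w f \<longleftrightarrow> (\<forall>k\<le>n.
    (\<forall>t\<in>I. \<forall>u. nth_derivative k (f t) differentiable (at u)) \<and>
    (\<exists>C. \<forall>t\<in>I. \<forall>u. norm (nth_derivative k (f t) u) \<le> C * (w t u / (1 + \<bar>u\<bar>) ^ k)))"

lemma symbol_bound_differentiable:
  "\<lbrakk>symbol_bound n I w f; k \<le> n; t \<in> I\<rbrakk> \<Longrightarrow> nth_derivative k (f t) differentiable (at u)"
  by (auto simp: symbol_bound_def)

lemma symbol_bound_has_derivative:
  "\<lbrakk>symbol_bound n I w f; k \<le> n; t \<in> I\<rbrakk> \<Longrightarrow>
    (nth_derivative k (f t) has_vector_derivative nth_derivative (Suc k) (f t) u) (at u)"
  using symbol_bound_differentiable[of n I w f k t u]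
  by (simp add: nth_derivative_Suc vector_derivative_works)

lemma symbol_bound_norm:
  assumes "symbol_bound n I w f" and "k \<le> n"
  obtains C where "\<And>t u. t \<in> I \<Longrightarrow> norm (nth_derivative k (f t) u) \<le> C * (w t u / (1 + \<bar>u\<bar>) ^ k)"
  using assms unfolding symbol_bound_def by meson

lemma symbol_bound_le: "\<lbrakk>symbol_bound n I w f; k \<le> n\<rbrakk> \<Longrightarrow> symbol_bound k I w f"
  by (auto simp: symbol_bound_def)

lemma symbol_bound_mono:
  assumes "symbol_bound n I w f" and "\<And>t u. t \<in> I \<Longrightarrow> 0 \<le> w t u \<and> w t u \<le> w' t u"
  shows "symbol_bound n I w' f"
  unfolding symbol_bound_def
proof (intro allI impI conjI ballI)
  fix k assume k: "k \<le> n"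
  obtain C where C: "\<And>t u. t \<in> I \<Longrightarrow> norm (nth_derivative k (f t) u) \<le> C * (w t u / (1 + \<bar>u\<bar>) ^ k)"
    by (rule symbol_bound_norm[OF assms(1) k], rule that)
  \<comment> \<open>The definition puts no sign on \<open>C\<close>, so enlarging the weight
    requires passing to \<open>\<bar>C\<bar>\<close>.\<close>
  have "norm (nth_derivative k (f t) u) \<le> \<bar>C\<bar> * (w' t u / (1 + \<bar>u\<bar>) ^ k)" if "t \<in> I" for t u
  proof -
    have "C * (w t u / (1 + \<bar>u\<bar>) ^ k) \<le> \<bar>C\<bar> * (w' t u / (1 + \<bar>u\<bar>) ^ k)"
      using assms(2)[OF that, of u] by (intro mult_mono divide_right_mono) auto
    with C[OF that, of u] show ?thesis by linarith
  qed
  then show "\<exists>C. \<forall>t\<in>I. \<forall>u. norm (nth_derivative k (f t) u) \<le> C * (w' t u / (1 + \<bar>u\<bar>) ^ k)"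
    by blast
qed (rule symbol_bound_differentiable[OF assms(1)])

section \<open>Recursion in the order of differentiation, and closure properties\<close>

lemma symbol_bound_0:
  "symbol_bound 0 I w f \<longleftrightarrow> (\<forall>t\<in>I. \<forall>u. f t differentiable (at u)) \<and>
    (\<exists>C. \<forall>t\<in>I. \<forall>u. norm (f t u) \<le> C * w t u)"
  by (simp add: symbol_bound_def)

text \<open>The gain \<open>1 / (1 + \<bar>u\<bar>)\<close> of one differentiation is moved into the
  weight. This makes induction on \<open>n\<close>, with arbitrary weights, the proof method for all
  closure properties.\<close>

lemma symbol_bound_Suc:
  assumes "\<And>t u. t \<in> I \<Longrightarrow> (f t has_vector_derivative f' t u) (at u)"
  shows "symbol_bound (Suc n) I w f \<longleftrightarrow>
    (\<exists>C. \<forall>t\<in>I. \<forall>u. norm (f t u) \<le> C * w t u) \<and> symbol_bound n I (\<lambda>t u. w t u / (1 + \<bar>u\<bar>)) f'"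
proof -
  have eq: "nth_derivative (Suc k) (f t) = nth_derivative k (f' t)" if "t \<in> I" for k t
    using assms[OF that] by (rule nth_derivative_Suc_inner)
  have diff: "f t differentiable (at u)" if "t \<in> I" for t u
    using assms[OF that] by (rule differentiableI_vector)
  have split: "(\<forall>k\<le>Suc n. P k) \<longleftrightarrow> P 0 \<and> (\<forall>k\<le>n. P (Suc k))" for P
    by (simp add: All_less_Suc2 flip: less_Suc_eq_le)
  show ?thesis
    unfolding symbol_bound_def split using diff by (simp add: eq)
qed

lemma symbol_bound_derivative:
  assumes "symbol_bound (Suc n) I w f"
  shows "symbol_bound n I (\<lambda>t u. w t u / (1 + \<bar>u\<bar>)) (\<lambda>t. nth_derivative (Suc 0) (f t))"
proof -
  note df = symbol_bound_has_derivative[OF assms, of 0, simplified]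
  have "symbol_bound (Suc n) I w f \<longleftrightarrow>
    (\<exists>C. \<forall>t\<in>I. \<forall>u. norm (f t u) \<le> C * w t u) \<and>
    symbol_bound n I (\<lambda>t u. w t u / (1 + \<bar>u\<bar>)) (\<lambda>t. nth_derivative (Suc 0) (f t))"
    by (rule symbol_bound_Suc[OF df])
  with assms show ?thesis by blast
qed

lemma symbol_bound_add:
  assumes "symbol_bound n I w f" and "symbol_bound n I w g"
  shows "symbol_bound n I w (\<lambda>t u. f t u + g t u)"
  using assms
proof (induction n arbitrary: w f g)
  case 0
  obtain C where C: "\<And>t u. t \<in> I \<Longrightarrow> norm (f t u) \<le> C * w t u"
    using symbol_bound_norm[OF 0(1), of 0] by auto
  obtain D where D: "\<And>t u. t \<in> I \<Longrightarrow> norm (g t u) \<le> D * w t u"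
    using symbol_bound_norm[OF 0(2), of 0] by auto
  have "\<forall>t\<in>I. \<forall>u. norm (f t u + g t u) \<le> (C + D) * w t u"
    using C D by (metis (no_types, lifting) add_mono distrib_right norm_triangle_le)
  with 0 show ?case
    unfolding symbol_bound_0 by (auto intro!: derivative_intros)
next
  case (Suc n)
  note df = symbol_bound_has_derivative[OF Suc.prems(1), of 0, simplified]
   and dg = symbol_bound_has_derivative[OF Suc.prems(2), of 0, simplified]
  obtain C where C: "\<And>t u. t \<in> I \<Longrightarrow> norm (f t u) \<le> C * w t u"
    using symbol_bound_norm[OF Suc.prems(1), of 0] by auto
  obtain D where D: "\<And>t u. t \<in> I \<Longrightarrow> norm (g t u) \<le> D * w t u"
    using symbol_bound_norm[OF Suc.prems(2), of 0] by auto
  have "\<forall>t\<in>I. \<forall>u. norm (f t u + g t u) \<le> (C + D) * w t u"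
    using C D by (metis (no_types, lifting) add_mono distrib_right norm_triangle_le)
  moreover have "symbol_bound n I (\<lambda>t u. w t u / (1 + \<bar>u\<bar>))
      (\<lambda>t u. nth_derivative (Suc 0) (f t) u + nth_derivative (Suc 0) (g t) u)"
    using Suc.prems by (intro Suc.IH symbol_bound_derivative)
  ultimately show ?case
    by (subst symbol_bound_Suc[OF has_vector_derivative_add[OF df dg]]) auto
qed

text \<open>Induction via the product rule: both \<open>f' g\<close> and \<open>f g'\<close> are
  products of order \<open>n\<close> with weight \<open>w v / (1 + \<bar>u\<bar>)\<close>, whichever
  factor was differentiated, so their sum is covered by \<open>symbol_bound_add\<close>.\<close>

lemma symbol_bound_mult:
  assumes "symbol_bound n I w f" and "symbol_bound n I v g"
  shows "symbol_bound n I (\<lambda>t u. w t u * v t u) (\<lambda>t u. f t u * g t u)"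
  using assms
proof (induction n arbitrary: w v f g)
  case 0
  obtain C where C: "\<And>t u. t \<in> I \<Longrightarrow> norm (f t u) \<le> C * w t u"
    using symbol_bound_norm[OF 0(1), of 0] by auto
  obtain D where D: "\<And>t u. t \<in> I \<Longrightarrow> norm (g t u) \<le> D * v t u"
    using symbol_bound_norm[OF 0(2), of 0] by auto
  have "norm (f t u * g t u) \<le> (C * w t u) * (D * v t u)" if "t \<in> I" for t u
    unfolding norm_mult using C[OF that, of u] D[OF that, of u]
    by (intro mult_mono) (auto intro: order_trans[OF norm_ge_zero])
  then have "\<forall>t\<in>I. \<forall>u. norm (f t u * g t u) \<le> (C * D) * (w t u * v t u)"
    by (simp add: mult_ac)
  with 0 show ?case
    unfolding symbol_bound_0 by (auto intro!: derivative_intros)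
next
  case (Suc n)
  note df = symbol_bound_has_derivative[OF Suc.prems(1), of 0, simplified]
   and dg = symbol_bound_has_derivative[OF Suc.prems(2), of 0, simplified]
  obtain C where C: "\<And>t u. t \<in> I \<Longrightarrow> norm (f t u) \<le> C * w t u"
    using symbol_bound_norm[OF Suc.prems(1), of 0] by auto
  obtain D where D: "\<And>t u. t \<in> I \<Longrightarrow> norm (g t u) \<le> D * v t u"
    using symbol_bound_norm[OF Suc.prems(2), of 0] by auto
  have "norm (f t u * g t u) \<le> (C * w t u) * (D * v t u)" if "t \<in> I" for t u
    unfolding norm_mult using C[OF that, of u] D[OF that, of u]
    by (intro mult_mono) (auto intro: order_trans[OF norm_ge_zero])
  then have "\<forall>t\<in>I. \<forall>u. norm (f t u * g t u) \<le> (C * D) * (w t u * v t u)"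
    by (simp add: mult_ac)
  moreover have "symbol_bound n I (\<lambda>t u. w t u * v t u / (1 + \<bar>u\<bar>))
      (\<lambda>t u. f t u * nth_derivative (Suc 0) (g t) u + nth_derivative (Suc 0) (f t) u * g t u)"
  proof (rule symbol_bound_add)
    have 1: "symbol_bound n I w f" "symbol_bound n I v g"
      using Suc.prems by (auto intro: symbol_bound_le)
    have 2: "symbol_bound n I (\<lambda>t u. w t u / (1 + \<bar>u\<bar>)) (\<lambda>t. nth_derivative (Suc 0) (f t))"
      "symbol_bound n I (\<lambda>t u. v t u / (1 + \<bar>u\<bar>)) (\<lambda>t. nth_derivative (Suc 0) (g t))"
      using Suc.prems by (auto intro: symbol_bound_derivative)
    show "symbol_bound n I (\<lambda>t u. w t u * v t u / (1 + \<bar>u\<bar>)) (\<lambda>t u. f t u * nth_derivative (Suc 0) (g t) u)"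
      using Suc.IH[OF 1(1) 2(2)] by simp
    show "symbol_bound n I (\<lambda>t u. w t u * v t u / (1 + \<bar>u\<bar>)) (\<lambda>t u. nth_derivative (Suc 0) (f t) u * g t u)"
      using Suc.IH[OF 2(1) 1(2)] by simp
  qed
  ultimately show ?case
    by (subst symbol_bound_Suc[OF has_vector_derivative_mult[OF df dg]]) auto
qed

text \<open>The constant may vary with \<open>t\<close>, and its modulus is the weight; in this way
  a factor \<open>t\<close> is tracked instead of being estimated. The derivative 0 admits every
  weight, with \<open>C = 0\<close>.\<close>

lemma symbol_bound_const: "symbol_bound n I (\<lambda>t u. norm (c t)) (\<lambda>t u. c t)"
proof -
  have zero: "symbol_bound n I w (\<lambda>t u. 0)" for n w
  proof (induction n arbitrary: w)
    case (Suc n)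
    have "symbol_bound (Suc n) I w (\<lambda>t u. 0) \<longleftrightarrow>
      (\<exists>C. \<forall>t\<in>I. \<forall>u. norm (0::complex) \<le> C * w t u) \<and> symbol_bound n I (\<lambda>t u. w t u / (1 + \<bar>u\<bar>)) (\<lambda>t u. 0)"
      by (rule symbol_bound_Suc) simp
    with Suc show ?case by (auto intro: exI[of _ 0])
  qed (auto simp: symbol_bound_0 intro: exI[of _ 0])
  show ?thesis
  proof (cases n)
    case (Suc k)
    show ?thesis
      unfolding Suc by (subst symbol_bound_Suc[where f' = "\<lambda>t u. 0"]) (auto intro: exI[of _ 1] zero)
  qed (auto simp: symbol_bound_0 intro: exI[of _ 1])
qed

text \<open>Growth like \<open>1 + \<bar>u\<bar>\<close> is exactly what one differentiation
  removes, leaving the constant \<open>c\<close> with weight \<open>norm c\<close>.\<close>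

lemma symbol_bound_linear: "symbol_bound n I (\<lambda>t u. norm c * (1 + \<bar>u\<bar>)) (\<lambda>t u. c * of_real u)"
proof -
  have bound: "norm (c * of_real u) \<le> 1 * (norm c * (1 + \<bar>u\<bar>))" for u
    by (simp add: norm_mult mult_left_mono)
  have deriv: "((\<lambda>u. c * of_real u) has_vector_derivative c) (at u)" for u :: real
    by (auto intro!: derivative_eq_intros)
  show ?thesis
  proof (cases n)
    case 0
    show ?thesis
      unfolding 0 symbol_bound_0
      by (intro conjI ballI allI exI[of _ 1] bound differentiableI_vector[OF deriv])
  next
    case (Suc k)
    have "(\<lambda>t u. norm c * (1 + \<bar>u\<bar>) / (1 + \<bar>u\<bar>)) = (\<lambda>(t::'a) (u::real). norm c)"
      by (auto intro!: ext simp: add_nonneg_eq_0_iff)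
    then show ?thesis
      unfolding Suc using bound symbol_bound_const[of k I "\<lambda>_. c"]
      by (subst symbol_bound_Suc[OF deriv]) (auto intro!: exI[of _ 1])
  qed
qed

lemma symbol_bound_power:
  assumes "symbol_bound n I w f"
  shows "symbol_bound n I (\<lambda>t u. w t u ^ m) (\<lambda>t u. f t u ^ m)"
proof (induction m)
  case 0
  then show ?case using symbol_bound_const[of n I "\<lambda>_. 1"] by simp
next
  case (Suc m)
  then show ?case using symbol_bound_mult[OF assms Suc] by simp
qed

text \<open>Lets \<open>symbol_bound_mult\<close> prove mere differentiability of products, without a Leibniz formula.\<close>

lemma symbol_bound_trivial_weight:
  assumes "\<And>k u. k \<le> n \<Longrightarrow> nth_derivative k f differentiable (at u)"
  obtains w where "symbol_bound n (UNIV :: unit set) w (\<lambda>_. f)"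
proof
  \<comment> \<open>Each summand, divided by its power of \<open>1 + \<bar>u\<bar>\<close>, is one
    of the norms to be bounded, so the constant 1 works for every order.\<close>
  let ?w = "\<lambda>(_::unit) u. \<Sum>k\<le>n. (1 + \<bar>u\<bar>) ^ k * norm (nth_derivative k f u)"
  have bound: "norm (nth_derivative k f u) \<le> 1 * (?w t u / (1 + \<bar>u\<bar>) ^ k)" if "k \<le> n" for k u and t :: unit
  proof -
    have "(1 + \<bar>u\<bar>) ^ k * norm (nth_derivative k f u) \<le> ?w t u"
      using that by (intro member_le_sum) auto
    moreover have "0 < (1 + \<bar>u\<bar>) ^ k" by (intro zero_less_power) linarith
    ultimately show ?thesis by (simp add: pos_le_divide_eq mult.commute)
  qed
  show "symbol_bound n UNIV ?w (\<lambda>_. f)"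
    unfolding symbol_bound_def
  proof (intro allI impI conjI ballI)
    fix k assume "k \<le> n"
    then show "\<exists>C. \<forall>t\<in>UNIV. \<forall>u. norm (nth_derivative k f u) \<le> C * (?w t u / (1 + \<bar>u\<bar>) ^ k)"
      by (intro exI[of _ 1] ballI allI bound)
  qed (rule assms)
qed

section \<open>Smoothness of the exponent\<close>

text \<open>The qualitative part of \<open>symbol_bound\<close> for a single function. Grading
  smoothness by \<open>n\<close> permits bootstrapping one order at a time.\<close>

definition differentiable_upto :: "nat \<Rightarrow> (real \<Rightarrow> complex) \<Rightarrow> bool" where
  "differentiable_upto n f \<longleftrightarrow> (\<forall>k\<le>n. \<forall>u. nth_derivative k f differentiable (at u))"

lemma smooth_iff_differentiable_upto: "smooth f \<longleftrightarrow> (\<forall>n. differentiable_upto n f)"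
  by (auto simp: smooth_def differentiable_upto_def)

lemma differentiable_upto_Suc:
  assumes "\<And>u. (f has_vector_derivative f' u) (at u)"
  shows "differentiable_upto (Suc n) f \<longleftrightarrow> differentiable_upto n f'"
  unfolding differentiable_upto_def
  using nth_derivative_Suc_inner[OF assms] differentiableI_vector[OF assms]
  by (simp add: All_less_Suc2 flip: less_Suc_eq_le)

lemma differentiable_upto_symbol_bound:
  "symbol_bound n (UNIV :: unit set) w (\<lambda>_. f) \<Longrightarrow> differentiable_upto n f"
  by (auto simp: symbol_bound_def differentiable_upto_def)

lemma differentiable_upto_const: "differentiable_upto n (\<lambda>_. c)"
  using differentiable_upto_symbol_bound[OF symbol_bound_const[of n UNIV "\<lambda>_. c"]] .

lemma differentiable_upto_mult:
  assumes "differentiable_upto n f" and "differentiable_upto n g"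
  shows "differentiable_upto n (\<lambda>u. f u * g u)"
proof -
  obtain v where v: "symbol_bound n (UNIV :: unit set) v (\<lambda>_. f)"
    using assms(1) symbol_bound_trivial_weight[of n f] unfolding differentiable_upto_def by blast
  obtain w where w: "symbol_bound n (UNIV :: unit set) w (\<lambda>_. g)"
    using assms(2) symbol_bound_trivial_weight[of n g] unfolding differentiable_upto_def by blast
  show ?thesis
    by (rule differentiable_upto_symbol_bound[OF symbol_bound_mult[OF v w]])
qed

text \<open>A continuous logarithm of a differentiable function is differentiable, because
  continuity keeps it locally on one branch of \<open>Ln\<close>.\<close>

lemma has_vector_derivative_exp_lift:
  fixes g :: "real \<Rightarrow> complex"
  assumes cont: "continuous_on UNIV g"
    and deriv: "((\<lambda>u. exp (g u)) has_vector_derivative d) (at u)"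
  shows "(g has_vector_derivative d * exp (- g u)) (at u)"
proof -
  \<comment> \<open>The branch of the logarithm that agrees with \<open>g\<close> near \<open>u\<close>.\<close>
  define h where "h y = g u + Ln (exp (g y) * exp (- g u))" for y
  have "((\<lambda>y. exp (g y) * exp (- g u)) has_vector_derivative d * exp (- g u)) (at u)"
    by (intro has_vector_derivative_mult_left deriv)
  moreover have "(Ln has_field_derivative 1) (at (exp (g u) * exp (- g u)))"
    by (auto intro!: derivative_eq_intros simp flip: exp_add)
  ultimately have "(Ln \<circ> (\<lambda>y. exp (g y) * exp (- g u)) has_vector_derivative d * exp (- g u) * 1) (at u)"
    by (rule field_vector_diff_chain_at)
  then have h: "(h has_vector_derivative d * exp (- g u)) (at u)"
    unfolding h_def by (auto intro!: derivative_eq_intros simp: o_def)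
  have "isCont g u"
    using cont by (simp add: continuous_on_eq_continuous_at)
  \<comment> \<open>Distance less than pi forces the imaginary part of \<open>g y - g u\<close> into
    the strip where the principal \<open>Ln\<close> inverts \<open>exp\<close>.\<close>
  then obtain e where "e > 0" and e: "\<And>y. dist y u < e \<Longrightarrow> dist (g y) (g u) < pi"
    unfolding continuous_at_eps_delta using pi_gt_zero by (metis dist_norm)
  have "h y = g y" if "dist y u < e" for y
  proof -
    have "\<bar>Im (g y - g u)\<bar> < pi"
      using e[OF that] abs_Im_le_cmod[of "g y - g u"] by (simp add: dist_norm)
    then have "Ln (exp (g y - g u)) = g y - g u"
      by (intro Ln_exp) auto
    then show ?thesis
      by (simp add: h_def exp_diff exp_minus field_simps)
  qed
  then show ?thesis
    using has_vector_derivative_transform_within[OF h \<open>e > 0\<close>, of g] by auto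
qed

text \<open>Bootstrapping: with \<open>d = (exp g)'\<close> and \<open>E = exp (- g)\<close> one has
  \<open>g' = d E\<close> and \<open>E' = - d E E\<close>. The right-hand sides contain only
  \<open>d\<close>, which is smooth, and \<open>E\<close>, so \<open>g\<close> and \<open>E\<close>
  gain an order of differentiability together.\<close>

lemma smooth_exp_lift:
  fixes g :: "real \<Rightarrow> complex"
  assumes cont: "continuous_on UNIV g" and smooth: "smooth (\<lambda>u. exp (g u))"
  shows "smooth g"
proof -
  let ?d = "nth_derivative (Suc 0) (\<lambda>u. exp (g u))" and ?E = "\<lambda>u. exp (- g u)"
  have d: "((\<lambda>u. exp (g u)) has_vector_derivative ?d u) (at u)" for u
    using smooth vector_derivative_works unfolding smooth_def nth_derivative_Suc
    by (metis nth_derivative_0)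
  have dg: "(g has_vector_derivative ?d u * ?E u) (at u)" for u
    using has_vector_derivative_exp_lift[OF cont d] .
  have "(exp \<circ> (\<lambda>u. - g u) has_vector_derivative - (?d u * ?E u) * exp (- g u)) (at u)" for u
    by (intro field_vector_diff_chain_at has_vector_derivative_minus dg DERIV_exp)
  then have dE: "(?E has_vector_derivative (?d u * ?E u) * (- 1 * ?E u)) (at u)" for u
    by (simp add: o_def)
  have sd: "differentiable_upto n ?d" for n
    using smooth differentiable_upto_Suc[OF d] by (simp add: smooth_iff_differentiable_upto)
  have "differentiable_upto n g \<and> differentiable_upto n ?E" for n
  proof (induction n)
    case 0
    show ?case
      by (simp add: differentiable_upto_def differentiableI_vector[OF dg] differentiableI_vector[OF dE])
  next
    case (Suc n)
    then show ?case
      unfolding differentiable_upto_Suc[OF dg] differentiable_upto_Suc[OF dE]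
      by (intro conjI differentiable_upto_mult sd differentiable_upto_const) auto
  qed
  then show ?thesis by (simp add: smooth_iff_differentiable_upto)
qed

section \<open>Symbol bounds for exponentials\<close>

text \<open>The derivative of \<open>exp (t g)\<close> is \<open>t g' exp (t g)\<close>, and
  \<open>t g'\<close> has weight \<open>t a / (1 + \<bar>u\<bar>)\<close>, at most
  \<open>(1 + t a) / (1 + \<bar>u\<bar>)\<close>. Each differentiation thus costs one power of
  \<open>1 + t a\<close>; the full power \<open>n\<close> is used for all orders up to
  \<open>n\<close> so as to have one weight.\<close>

lemma symbol_bound_exp:
  fixes g :: "real \<Rightarrow> complex"
  assumes I: "\<And>t. t \<in> I \<Longrightarrow> 0 \<le> t" and a: "\<And>u. 0 \<le> a u" and e: "\<And>t u. 0 \<le> e t u"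
    and dg: "\<And>u. (g has_vector_derivative g' u) (at u)"
    and g': "symbol_bound n I (\<lambda>t u. a u / (1 + \<bar>u\<bar>)) (\<lambda>_. g')"
    and bound: "\<And>t u. t \<in> I \<Longrightarrow> norm (exp (of_real t * g u)) \<le> K * e t u"
  shows "symbol_bound n I (\<lambda>t u. (1 + t * a u) ^ n * e t u) (\<lambda>t u. exp (of_real t * g u))"
  using g'
proof (induction n)
  have "(exp \<circ> (\<lambda>u. of_real t * g u) has_vector_derivative (of_real t * g' u) * exp (of_real t * g u)) (at u)" for t u
    by (intro field_vector_diff_chain_at has_vector_derivative_mult_right dg DERIV_exp)
  then have df: "((\<lambda>u. exp (of_real t * g u)) has_vector_derivative
      (of_real t * g' u) * exp (of_real t * g u)) (at u)" for t u
    by (simp add: o_def)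
  {
    case 0
    then show ?case
      using bound by (auto simp: symbol_bound_0 differentiableI_vector[OF df])
  next
    case (Suc n)
    have K: "norm (exp (of_real t * g u)) \<le> \<bar>K\<bar> * ((1 + t * a u) ^ Suc n * e t u)" if "t \<in> I" for t u
    proof -
      have "1 * e t u \<le> (1 + t * a u) ^ Suc n * e t u"
        using I[OF that] a[of u] e[of t u] by (intro mult_right_mono one_le_power) auto
      then have "K * e t u \<le> \<bar>K\<bar> * ((1 + t * a u) ^ Suc n * e t u)"
        using e[of t u] by (intro mult_mono) auto
      with bound[OF that, of u] show ?thesis by linarith
    qed
    have "symbol_bound n I (\<lambda>t u. (norm (of_real t :: complex) * (a u / (1 + \<bar>u\<bar>))) * ((1 + t * a u) ^ n * e t u))
        (\<lambda>t u. (of_real t * g' u) * exp (of_real t * g u))"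
      using Suc.prems Suc.IH[OF symbol_bound_le[OF Suc.prems]]
      by (intro symbol_bound_mult symbol_bound_const) (auto intro: symbol_bound_le)
    then have "symbol_bound n I (\<lambda>t u. (1 + t * a u) ^ Suc n * e t u / (1 + \<bar>u\<bar>))
        (\<lambda>t u. (of_real t * g' u) * exp (of_real t * g u))"
    proof (rule symbol_bound_mono)
      fix t u assume t: "t \<in> I"
      have "t * a u * ((1 + t * a u) ^ n * e t u) \<le> (1 + t * a u) * ((1 + t * a u) ^ n * e t u)"
        using I[OF t] a[of u] e[of t u] by (intro mult_right_mono) auto
      then have "t * a u * ((1 + t * a u) ^ n * e t u) / (1 + \<bar>u\<bar>)
          \<le> (1 + t * a u) * ((1 + t * a u) ^ n * e t u) / (1 + \<bar>u\<bar>)"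
        by (intro divide_right_mono) auto
      then show "0 \<le> (norm (of_real t :: complex) * (a u / (1 + \<bar>u\<bar>))) * ((1 + t * a u) ^ n * e t u) \<and>
          (norm (of_real t :: complex) * (a u / (1 + \<bar>u\<bar>))) * ((1 + t * a u) ^ n * e t u)
            \<le> (1 + t * a u) ^ Suc n * e t u / (1 + \<bar>u\<bar>)"
        using I[OF t] a[of u] e[of t u] by (simp add: mult_ac)
    qed
    then show ?case
      using K by (subst symbol_bound_Suc[OF df]) blast
  }
qed

text \<open>Extends a bound near infinity to the whole line, with \<open>1 + \<bar>u\<bar>\<close>
  replacing \<open>\<bar>u\<bar>\<close> to avoid the singularity at 0: on a compact interval the
  quotient by the positive weight is bounded by continuity.\<close>

lemma powr_decay_imp_weight_bound:
  fixes h :: "real \<Rightarrow> complex"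
  assumes cont: "continuous_on UNIV h"
    and decay: "\<And>u. \<bar>u\<bar> > R \<Longrightarrow> norm (h u) \<le> c * \<bar>u\<bar> powr (\<beta> - real i)" and \<beta>: "0 \<le> \<beta>"
  obtains C where "\<And>u. norm (h u) \<le> C * ((1 + \<bar>u\<bar>) powr \<beta> / (1 + \<bar>u\<bar>) ^ i)"
proof -
  define w where "w u = (1 + \<bar>u\<bar>) powr \<beta> / (1 + \<bar>u\<bar>) ^ i" for u :: real
  \<comment> \<open>Outside \<open>[-S, S]\<close> one has \<open>\<bar>u\<bar> > 1\<close>, hence
    \<open>\<bar>u\<bar> \<ge> (1 + \<bar>u\<bar>) / 2\<close>; this is the source of the factor
    \<open>2 ^ i\<close>.\<close>
  define S where "S = max R 1"
  have w: "0 < w u" for u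
    unfolding w_def by (intro divide_pos_pos zero_less_power) (auto intro: add_pos_nonneg)
  have "continuous_on {-S..S} (\<lambda>u. norm (h u) / w u)"
    unfolding w_def by (intro continuous_intros continuous_on_subset[OF cont]) (auto simp: add_nonneg_eq_0_iff)
  then have "bounded ((\<lambda>u. norm (h u) / w u) ` {-S..S})"
    by (intro compact_imp_bounded compact_continuous_image) auto
  then obtain B where "\<forall>y\<in>(\<lambda>u. norm (h u) / w u) ` {-S..S}. norm y \<le> B"
    unfolding bounded_iff by blast
  then have "norm (norm (h u) / w u) \<le> B" if "u \<in> {-S..S}" for u
    using that by blast
  then have B: "norm (h u) / w u \<le> B" if "u \<in> {-S..S}" for u
    using that by (simp add: abs_of_pos[OF w])
  have "norm (h u) \<le> max B (\<bar>c\<bar> * 2 ^ i) * w u" for u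
  proof (cases "\<bar>u\<bar> \<le> S")
    case True
    then have "norm (h u) / w u \<le> max B (\<bar>c\<bar> * 2 ^ i)"
      using B[of u] by (simp add: abs_le_iff le_max_iff_disj)
    then show ?thesis using w[of u] by (simp add: pos_divide_le_eq)
  next
    case False
    then have u: "1 < \<bar>u\<bar>" "R < \<bar>u\<bar>" by (auto simp: S_def)
    have "\<bar>u\<bar> powr (\<beta> - real i) = \<bar>u\<bar> powr \<beta> / \<bar>u\<bar> ^ i"
      using u by (simp add: powr_diff powr_realpow)
    also have "\<dots> \<le> (1 + \<bar>u\<bar>) powr \<beta> / ((1 + \<bar>u\<bar>) / 2) ^ i"
      using u \<beta> by (intro frac_le powr_mono2 power_mono zero_less_power) auto
    also have "\<dots> = 2 ^ i * w u"
      by (simp add: w_def power_divide)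
    finally have "c * \<bar>u\<bar> powr (\<beta> - real i) \<le> \<bar>c\<bar> * (2 ^ i * w u)"
      by (intro mult_mono) auto
    then have "norm (h u) \<le> (\<bar>c\<bar> * 2 ^ i) * w u"
      using decay[OF u(2)] by simp
    also have "\<dots> \<le> max B (\<bar>c\<bar> * 2 ^ i) * w u"
      using w[of u] by (intro mult_right_mono) auto
    finally show ?thesis .
  qed
  then show thesis unfolding w_def by (rule that)
qed

text \<open>Take the \<open>N\<close>-th power of \<open>y \<le> exp y\<close> at
  \<open>y = c (1 + s) / N\<close>; the case \<open>N = 0\<close> is separate because of this
  division.\<close>

lemma power_mult_exp_minus_bounded:
  assumes "c > 0"
  obtains C where "\<And>s::real. 0 \<le> s \<Longrightarrow> (1 + s) ^ N * exp (- c * s) \<le> C"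
proof (cases "N = 0")
  case True
  show ?thesis by (rule that[of 1]) (use True assms in auto)
next
  case False
  have "(1 + s) ^ N * exp (- c * s) \<le> (real N / c) ^ N * exp c" if "0 \<le> s" for s
  proof -
    have "c * (1 + s) / real N \<le> exp (c * (1 + s) / real N)"
      using exp_ge_add_one_self[of "c * (1 + s) / real N"] by linarith
    then have "(1 + s) \<le> (real N / c) * exp (c * (1 + s) / real N)"
      using False assms by (simp add: field_simps)
    then have "(1 + s) ^ N \<le> ((real N / c) * exp (c * (1 + s) / real N)) ^ N"
      using that by (intro power_mono) auto
    also have "\<dots> = (real N / c) ^ N * exp (c * (1 + s))"
      unfolding power_mult_distrib exp_of_nat_mult[symmetric] using False by simp
    finally have "(1 + s) ^ N * exp (- c * s) \<le> (real N / c) ^ N * exp (c * (1 + s)) * exp (- c * s)"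
      by (intro mult_right_mono) auto
    also have "\<dots> = (real N / c) ^ N * exp c"
      by (simp add: algebra_simps flip: exp_add)
    finally show ?thesis .
  qed
  then show ?thesis by (rule that)
qed

section \<open>Fourier integrals\<close>

text \<open>Differentiation under the integral sign. By the mean value inequality the remainder
  quotient is dominated by \<open>2 w\<close>, so dominated convergence applies along every sequence
  tending to 0.\<close>

lemma has_vector_derivative_integral:
  fixes f :: "real \<Rightarrow> 'b \<Rightarrow> 'c::{banach, second_countable_topology}"
  assumes int: "\<And>y. integrable M (f y)" and meas: "f' x \<in> borel_measurable M"
    and deriv: "\<And>y u. ((\<lambda>y. f y u) has_vector_derivative f' y u) (at y)"
    and bound: "\<And>y u. norm (f' y u) \<le> w u" and w: "integrable M w"
  shows "((\<lambda>y. \<integral>u. f y u \<partial>M) has_vector_derivative (\<integral>u. f' x u \<partial>M)) (at x)"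
proof -
  let ?r = "\<lambda>h u. norm (f (x + h) u - f x u - h *\<^sub>R f' x u) / \<bar>h\<bar>"
  have int': "integrable M (f' x)"
    using w meas by (rule Bochner_Integration.integrable_bound)
      (use bound in \<open>auto intro: order_trans[OF _ abs_ge_self]\<close>)
  have r_le: "?r h u \<le> 2 * w u" for h u
  proof -
    have "norm (f (x + h) u - f x u) \<le> w u * norm (x + h - x)"
    proof (rule differentiable_bound[where S = UNIV])
      show "((\<lambda>y. f y u) has_derivative (\<lambda>h. h *\<^sub>R f' y u)) (at y within UNIV)" for y
        using deriv by (simp add: has_vector_derivative_def)
      show "onorm (\<lambda>h. h *\<^sub>R f' y u) \<le> w u" for y
        using bound[of y u] by (intro onorm_le) (simp add: mult.commute[of "w u"] mult_left_mono)
    qed auto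
    moreover have "norm (h *\<^sub>R f' x u) \<le> w u * \<bar>h\<bar>"
      using bound[of x u] by (simp add: mult.commute[of "w u"] mult_left_mono)
    ultimately have "norm (f (x + h) u - f x u - h *\<^sub>R f' x u) \<le> 2 * w u * \<bar>h\<bar>"
      using norm_triangle_ineq4[of "f (x + h) u - f x u" "h *\<^sub>R f' x u"] by simp
    moreover have "0 \<le> w u" using bound[of x u] norm_ge_zero order_trans by blast
    \<comment> \<open>At \<open>h = 0\<close> the quotient is 0 by the convention for division by
      zero, and nonnegativity of \<open>w\<close> suffices.\<close>
    ultimately show ?thesis by (cases "h = 0") (auto simp: pos_divide_le_eq)
  qed
  have "(\<lambda>h. norm ((\<integral>u. f (x + h) u \<partial>M) - (\<integral>u. f x u \<partial>M) - h *\<^sub>R (\<integral>u. f' x u \<partial>M)) / norm h) \<midarrow>0\<rightarrow> 0"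
    (is "?q \<midarrow>0\<rightarrow> 0")
    unfolding tendsto_at_iff_sequentially
  proof (intro allI impI)
    fix X :: "nat \<Rightarrow> real" assume X: "\<forall>i. X i \<in> UNIV - {0}" "X \<longlonglongrightarrow> 0"
    have "(\<lambda>i. \<integral>u. ?r (X i) u \<partial>M) \<longlonglongrightarrow> (\<integral>u. 0 \<partial>M)"
    proof (rule integral_dominated_convergence[where w = "\<lambda>u. 2 * w u"])
      show "(\<lambda>u. ?r (X i) u) \<in> borel_measurable M" for i
        using borel_measurable_integrable[OF int] meas by measurable
      show "AE u in M. (\<lambda>i. ?r (X i) u) \<longlonglongrightarrow> 0"
      proof (rule AE_I2)
        fix u
        have "(\<lambda>h. ?r h u) \<midarrow>0\<rightarrow> 0"
          using deriv[where y = x and u = u] unfolding has_vector_derivative_def has_derivative_at by simp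
        then show "(\<lambda>i. ?r (X i) u) \<longlonglongrightarrow> 0"
          using X unfolding tendsto_at_iff_sequentially by (simp add: o_def)
      qed
    qed (use w r_le in auto)
    moreover have "norm (?q (X i)) \<le> (\<integral>u. ?r (X i) u \<partial>M)" for i
    proof -
      have "(\<integral>u. f (x + X i) u \<partial>M) - (\<integral>u. f x u \<partial>M) - X i *\<^sub>R (\<integral>u. f' x u \<partial>M)
          = (\<integral>u. f (x + X i) u - f x u - X i *\<^sub>R f' x u \<partial>M)"
        using int int' by simp
      then have "?q (X i) \<le> (\<integral>u. norm (f (x + X i) u - f x u - X i *\<^sub>R f' x u) \<partial>M) / \<bar>X i\<bar>"
        by (simp add: divide_right_mono)
      then show ?thesis by simp
    qed
    ultimately show "(?q \<circ> X) \<longlonglongrightarrow> 0"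
      by (intro Lim_null_comparison[of "?q \<circ> X" "\<lambda>i. \<integral>u. ?r (X i) u \<partial>M"]) auto
  qed
  then show ?thesis
    unfolding has_vector_derivative_def has_derivative_at
    by (auto intro: bounded_linear_scaleR_left)
qed

lemma fourier_integral_has_derivative:
  fixes g :: "real \<Rightarrow> complex"
  assumes g: "integrable lborel g" and ug: "integrable lborel (\<lambda>u. - \<i> * of_real u * g u)"
  shows "((\<lambda>x. \<integral>u. iexp (- (u * x)) * g u \<partial>lborel) has_vector_derivative
    (\<integral>u. iexp (- (u * x)) * (- \<i> * of_real u * g u) \<partial>lborel)) (at x)"
proof (rule has_vector_derivative_integral[where w = "\<lambda>u. norm (- \<i> * of_real u * g u)"])
  have [measurable]: "g \<in> borel_measurable borel" using borel_measurable_integrable[OF g] by simp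
  show "integrable lborel (\<lambda>u. norm (- \<i> * of_real u * g u))"
    using ug by (rule integrable_norm)
  show "integrable lborel (\<lambda>u. iexp (- (u * y)) * g u)" for y
    by (rule Bochner_Integration.integrable_bound[OF g]) (auto simp: norm_mult)
  show "(\<lambda>u. iexp (- (u * x)) * (- \<i> * of_real u * g u)) \<in> borel_measurable lborel"
    by measurable
  show "((\<lambda>y. iexp (- (u * y)) * g u) has_vector_derivative iexp (- (u * y)) * (- \<i> * of_real u * g u)) (at y)" for y u
    by (auto intro!: derivative_eq_intros has_vector_derivative_real_field simp: algebra_simps)
qed (auto simp: norm_mult)

section \<open>Integration by parts under quadratic decay\<close>

lemma integrable_inverse_1_plus_square_lborel: "integrable lborel (\<lambda>x::real. inverse (1 + x\<^sup>2))"
  using integrable_inverse_1_plus_square by (simp add: set_integrable_def)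

lemma integrable_quadratic_decay:
  fixes g :: "real \<Rightarrow> complex"
  assumes "g \<in> borel_measurable borel" and "\<And>u. norm (g u) \<le> B * inverse (1 + u\<^sup>2)"
  shows "integrable lborel g"
  by (rule Bochner_Integration.integrable_bound[of _ "\<lambda>u. B * inverse (1 + u\<^sup>2)"])
    (use assms integrable_inverse_1_plus_square_lborel in \<open>auto intro: order_trans[OF _ abs_ge_self]\<close>)

text \<open>Fundamental theorem of calculus on the whole line for
  \<open>iexp (- (u * x)) * g u\<close>. Quadratic decay gives both the integrability and the
  vanishing of the boundary terms.\<close>

lemma fourier_integral_by_parts:
  fixes g :: "real \<Rightarrow> complex"
  assumes dg: "\<And>u. (g has_vector_derivative g' u) (at u)" and cont: "\<And>u. isCont g' u"
    and B: "\<And>u. norm (g u) \<le> B * inverse (1 + u\<^sup>2)" and B': "\<And>u. norm (g' u) \<le> B' * inverse (1 + u\<^sup>2)"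
  shows "(\<integral>u. iexp (- (u * x)) * g' u \<partial>lborel) = \<i> * of_real x * (\<integral>u. iexp (- (u * x)) * g u \<partial>lborel)"
proof -
  let ?h = "\<lambda>u. iexp (- (u * x)) * g u"
  let ?h' = "\<lambda>u. iexp (- (u * x)) * g' u - \<i> * of_real x * (iexp (- (u * x)) * g u)"
  have contg: "isCont g u" for u using dg by (rule has_vector_derivative_continuous)
  have [measurable]: "g \<in> borel_measurable borel" "g' \<in> borel_measurable borel"
    using cont contg by (auto intro!: borel_measurable_continuous_onI simp: continuous_on_eq_continuous_at)
  have int: "integrable lborel (\<lambda>u. iexp (- (u * x)) * g u)" "integrable lborel (\<lambda>u. iexp (- (u * x)) * g' u)"
    by (rule integrable_quadratic_decay[of _ B] integrable_quadratic_decay[of _ B'],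
        use B B' in \<open>auto simp: norm_mult\<close>)+
  have "eventually (\<lambda>u. norm (?h u) \<le> B * inverse (1 + u\<^sup>2)) F" for F
    using B by (auto simp: norm_mult)
  then have h_lim: "(?h \<longlongrightarrow> 0) F" if "((\<lambda>u. B * inverse (1 + u\<^sup>2)) \<longlongrightarrow> 0) F" for F
    using that by (rule Lim_null_comparison)
  have lim: "(?h \<longlongrightarrow> 0) at_top" "(?h \<longlongrightarrow> 0) at_bot"
    by (rule h_lim, real_asymp)+
  have "(LBINT u=-\<infinity>..\<infinity>. ?h' u) = 0 - 0"
  proof (rule interval_integral_FTC_integrable[where F = ?h])
    show "(?h has_vector_derivative ?h' u) (at u)" for u
      using dg by (auto intro!: derivative_eq_intros has_vector_derivative_real_field simp: algebra_simps)
    show "isCont ?h' u" for u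
      using cont contg by (intro continuous_intros) auto
    show "set_integrable lborel (einterval (-\<infinity>) \<infinity>) ?h'"
      using int by (simp add: set_integrable_def)
  qed (use lim in \<open>auto simp: ereal_tendsto_simps\<close>)
  then have "(\<integral>u. ?h' u \<partial>lborel) = 0"
    by (simp add: interval_lebesgue_integral_def set_lebesgue_integral_def)
  then show ?thesis
    using int by simp
qed

lemma fourier_integral_nth_derivative:
  fixes g :: "real \<Rightarrow> complex"
  assumes "\<And>k u. k \<le> n \<Longrightarrow> nth_derivative k g differentiable (at u)"
    and "\<And>k. k \<le> n \<Longrightarrow> \<exists>B. \<forall>u. norm (nth_derivative k g u) \<le> B * inverse (1 + u\<^sup>2)"
  shows "(\<integral>u. iexp (- (u * x)) * nth_derivative n g u \<partial>lborel) =
    (\<i> * of_real x) ^ n * (\<integral>u. iexp (- (u * x)) * g u \<partial>lborel)"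
  using assms
proof (induction n)
  case (Suc n)
  obtain B B' where "\<And>u. norm (nth_derivative n g u) \<le> B * inverse (1 + u\<^sup>2)"
    "\<And>u. norm (nth_derivative (Suc n) g u) \<le> B' * inverse (1 + u\<^sup>2)"
    using Suc.prems(2)[of n] Suc.prems(2)[of "Suc n"] by auto
  moreover have "(nth_derivative n g has_vector_derivative nth_derivative (Suc n) g u) (at u)" for u
    using Suc.prems(1)[of n u] by (simp add: nth_derivative_Suc vector_derivative_works)
  moreover have "isCont (nth_derivative (Suc n) g) u" for u
    using Suc.prems(1)[of "Suc n" u] by (simp add: differentiable_imp_continuous_within)
  ultimately have "(\<integral>u. iexp (- (u * x)) * nth_derivative (Suc n) g u \<partial>lborel) =
      \<i> * of_real x * (\<integral>u. iexp (- (u * x)) * nth_derivative n g u \<partial>lborel)"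
    by (intro fourier_integral_by_parts[where B = B and B' = B'])
  moreover have "(\<integral>u. iexp (- (u * x)) * nth_derivative n g u \<partial>lborel) =
      (\<i> * of_real x) ^ n * (\<integral>u. iexp (- (u * x)) * g u \<partial>lborel)"
    using Suc.prems by (intro Suc.IH) auto
  ultimately show ?case
    by (simp only: power_Suc mult.assoc)
qed simp

text \<open>Levy's inversion formula expresses increments of an antiderivative \<open>F\<close> of
  \<open>p\<close> through the characteristic function. Integrability of the latter turns the limit
  in that formula into an integral over the line, which is then differentiated in the right
  endpoint.\<close>

lemma (in prob_space) fourier_inversion:
  assumes Y: "continuous_density M Y p" and int: "integrable lborel (char (distr M borel Y))"
  shows "of_real (p x) = (\<integral>u. iexp (- (u * x)) * char (distr M borel Y) u \<partial>lborel) / (2 * pi)"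
proof -
  let ?N = "distr M borel Y" and ?\<phi> = "char (distr M borel Y)"
  have p: "\<And>x. isCont p x" "\<And>x. 0 \<le> p x" and distr: "distributed M lborel Y (\<lambda>x. ennreal (p x))"
    using Y by (auto simp: continuous_density_def continuous_on_eq_continuous_at)
  have [measurable]: "p \<in> borel_measurable borel"
    using p(1) by (auto intro!: borel_measurable_continuous_onI simp: continuous_on_eq_continuous_at)
  have "Y \<in> measurable M borel"
    using distributed_measurable[OF distr] by simp
  then interpret N: real_distribution ?N
    by (simp add: real_distribution_def real_distribution_axioms_def prob_space_distr)
  have N: "?N = density lborel (\<lambda>x. ennreal (p x))"
    using distributed_distr_eq_density[OF distr] by (simp cong: distr_cong)
  obtain F where F: "\<And>x. (F has_vector_derivative p x) (at x)"
    using einterval_antiderivative[of "-\<infinity>" "\<infinity>" p] p(1) by auto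
  then have F_real: "(F has_real_derivative p x) (at x)" for x
    by (simp add: has_real_derivative_iff_has_vector_derivative)
  \<comment> \<open>Without atoms every endpoint is admissible in Levy's formula, and closed and
    half-open intervals have the same measure.\<close>
  have point: "measure ?N {a} = 0" for a
  proof -
    have "emeasure ?N {a} = 0"
      unfolding N using absolutely_continuousI_density[of "\<lambda>x. ennreal (p x)" lborel]
      by (auto simp: absolutely_continuous_def dest!: subsetD[of _ _ "{a}"])
    then show ?thesis by (simp add: measure_def)
  qed
  have interval: "measure ?N {a<..b} = F b - F a" if "a \<le> b" for a b
  proof -
    have "emeasure ?N {a..b} = (\<integral>\<^sup>+x. ennreal (p x) * indicator {a..b} x \<partial>lborel)"
      unfolding N by (simp add: emeasure_density)
    also have "\<dots> = ennreal (F b - F a)"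
      using that F_real p by (intro nn_integral_FTC_Icc) auto
    finally have 1: "emeasure ?N {a..b} = ennreal (F b - F a)" .
    have "F a \<le> F b"
      using that F_real p(2) by (intro DERIV_nonneg_imp_nondecreasing[of a b F]) auto
    with 1 have "measure ?N {a..b} = F b - F a" by (simp add: measure_def)
    moreover have "measure ?N {a..b} = measure ?N {a} + measure ?N {a<..b}"
      using that by (subst N.finite_measure_Union[symmetric]) (auto intro!: arg_cong[of _ _ "measure ?N"])
    ultimately show ?thesis using point by simp
  qed
  \<comment> \<open>For \<open>u \<noteq> 0\<close> this is the integral of
    \<open>iexp (- (u * y))\<close> over \<open>y\<close> from \<open>a\<close> to \<open>b\<close>,
    whence the bound \<open>\<bar>b - a\<bar>\<close> and the derivative
    \<open>iexp (- (u * b))\<close> in \<open>b\<close>.\<close>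
  define k where "k a b u = (iexp (- (u * a)) - iexp (- (u * b))) / (\<i> * of_real u)" for a b u :: real
  have k_meas [measurable]: "k a b \<in> borel_measurable borel" for a b
    unfolding k_def by measurable
  have k_bound: "norm (k a b u) \<le> \<bar>b - a\<bar>" for a b u
  proof -
    have *: "norm (k a b u) \<le> b - a" if "a \<le> b" "u \<noteq> 0" for a b
      using Levy_Inversion_aux2[of "- b" "- a" u] that by (simp add: k_def)
    show ?thesis
    proof (cases "u = 0")
      case False
      have "norm (k a b u) = norm (k b a u)"
        by (simp add: k_def norm_divide norm_minus_commute)
      then show ?thesis using *[of a b] *[of b a] False by (cases "a \<le> b") auto
    qed (simp add: k_def)
  qed
  have k_int: "integrable lborel (\<lambda>u. k a b u * ?\<phi> u)" for a b
    by (rule Bochner_Integration.integrable_bound[of _ "\<lambda>u. \<bar>b - a\<bar> * norm (?\<phi> u)"])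
      (use int k_bound in \<open>auto simp: norm_mult mult_right_mono\<close>)
  have levy: "(\<integral>u. k a b u * ?\<phi> u \<partial>lborel) = of_real (2 * pi * (F b - F a))" if "a \<le> b" for a b
  proof -
    have "(\<lambda>T. 1 / (2 * pi) * (CLBINT u=-(real T)..real T. k a b u * ?\<phi> u)) \<longlonglongrightarrow> measure ?N {a<..b}"
      using N.Levy_Inversion[OF that point point] unfolding k_def by simp
    moreover have "(\<lambda>T. CLBINT u=-(real T)..real T. k a b u * ?\<phi> u) \<longlonglongrightarrow> (\<integral>u. k a b u * ?\<phi> u \<partial>lborel)"
    proof -
      have "(\<lambda>T. \<integral>u. indicator {-(real T)<..<real T} u *\<^sub>R (k a b u * ?\<phi> u) \<partial>lborel)
          \<longlonglongrightarrow> (\<integral>u. k a b u * ?\<phi> u \<partial>lborel)"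
      proof (rule integral_dominated_convergence[where w = "\<lambda>u. norm (k a b u * ?\<phi> u)"])
        show "AE u in lborel. (\<lambda>T. indicator {-(real T)<..<real T} u *\<^sub>R (k a b u * ?\<phi> u)) \<longlonglongrightarrow> k a b u * ?\<phi> u"
        proof (rule AE_I2, rule tendsto_eventually)
          fix u :: real
          obtain T0 :: nat where "\<bar>u\<bar> < T0" using reals_Archimedean2 by blast
          then show "\<forall>\<^sub>F T in sequentially. indicator {-(real T)<..<real T} u *\<^sub>R (k a b u * ?\<phi> u) = k a b u * ?\<phi> u"
            by (intro eventually_sequentiallyI[of T0]) (auto simp: indicator_def)
        qed
      qed (use k_int in \<open>auto split: split_indicator\<close>)
      then show ?thesis
        by (simp add: interval_lebesgue_integral_def set_lebesgue_integral_def)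
    qed
    then have "(\<lambda>T. 1 / (2 * pi) * (CLBINT u=-(real T)..real T. k a b u * ?\<phi> u))
        \<longlonglongrightarrow> 1 / (2 * pi) * (\<integral>u. k a b u * ?\<phi> u \<partial>lborel)"
      by (rule tendsto_mult_left)
    ultimately have "of_real (measure ?N {a<..b}) = 1 / (2 * pi) * (\<integral>u. k a b u * ?\<phi> u \<partial>lborel)"
      by (rule LIMSEQ_unique)
    then have "of_real (F b - F a) = 1 / (2 * pi) * (\<integral>u. k a b u * ?\<phi> u \<partial>lborel)"
      unfolding interval[OF that] .
    then show ?thesis by (simp add: field_simps)
  qed
  \<comment> \<open>Since \<open>k a b 0 = 0\<close> (division by zero), the derivative in \<open>b\<close> is exceptional at \<open>u = 0\<close>.\<close>
  have "((\<lambda>b. \<integral>u. k (x - 1) b u * ?\<phi> u \<partial>lborel) has_vector_derivative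
      (\<integral>u. (if u = 0 then 0 else iexp (- (u * x)) * ?\<phi> u) \<partial>lborel)) (at x)"
  proof (rule has_vector_derivative_integral[where w = "\<lambda>u. norm (?\<phi> u)"])
    show "((\<lambda>b. k (x - 1) b u * ?\<phi> u) has_vector_derivative
        (if u = 0 then 0 else iexp (- (u * b)) * ?\<phi> u)) (at b)" for b u
      unfolding k_def
      by (auto intro!: derivative_eq_intros has_vector_derivative_real_field simp: field_simps)
  qed (use int k_int in \<open>auto simp: norm_mult\<close>)
  also have "(\<integral>u. (if u = 0 then 0 else iexp (- (u * x)) * ?\<phi> u) \<partial>lborel)
      = (\<integral>u. iexp (- (u * x)) * ?\<phi> u \<partial>lborel)"
    by (intro integral_cong_AE eventually_mono[OF AE_lborel_singleton[of 0]]) auto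
  \<comment> \<open>The left endpoint \<open>x - 1\<close> lies below every \<open>b\<close> within
    distance 1 of \<open>x\<close>, so \<open>levy\<close>, which needs ordered endpoints, covers a
    neighbourhood of \<open>x\<close>.\<close>
  finally have "((\<lambda>b. of_real (2 * pi * (F b - F (x - 1)))) has_vector_derivative
      (\<integral>u. iexp (- (u * x)) * ?\<phi> u \<partial>lborel)) (at x)"
    by (rule has_vector_derivative_transform_within[of _ _ _ _ 1]) (auto simp: levy dist_real_def)
  moreover have "((\<lambda>b. 2 * pi * (F b - F (x - 1))) has_vector_derivative 2 * pi * p x) (at x)"
    using F[of x] by (auto intro!: derivative_eq_intros)
  then have "((\<lambda>b. complex_of_real (2 * pi * (F b - F (x - 1)))) has_vector_derivative
      of_real (2 * pi * p x)) (at x)"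
    by (intro has_vector_derivative_of_real) (simp add: has_real_derivative_iff_has_vector_derivative)
  ultimately have "(\<integral>u. iexp (- (u * x)) * ?\<phi> u \<partial>lborel) = of_real (2 * pi * p x)"
    by (rule vector_derivative_unique_at)
  then show ?thesis by simp
qed

section \<open>The uniform bound\<close>

text \<open>Makes the modulus of a characteristic function even, which carries a one-sided decay
  condition over to negative arguments.\<close>

lemma (in real_distribution) char_minus: "char M (- u) = cnj (char M u)"
  by (simp add: char_def exp_cnj flip: Bochner_Integration.integral_cnj)

section \<open>Weight estimates: uniform in \<open>t\<close> at order \<open>m + 2\<close>, and for
  fixed \<open>t\<close> at every order\<close>

lemma inverse_square_weight_le: "1 / (1 + \<bar>u\<bar>)\<^sup>2 \<le> inverse (1 + u\<^sup>2)" for u :: real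
proof -
  have "1 + u\<^sup>2 \<le> (1 + \<bar>u\<bar>)\<^sup>2"
    by (simp add: power2_sum)
  moreover have "0 < 1 + u\<^sup>2" by (rule add_pos_nonneg) auto
  ultimately show ?thesis by (simp add: inverse_eq_divide frac_le)
qed

text \<open>The powers of \<open>1 + \<bar>u\<bar>\<close> leave
  \<open>(1 + \<bar>u\<bar>) ^ 2\<close> in the denominator; the rest depends on \<open>t\<close>
  and \<open>u\<close> only through \<open>s = t (1 + \<bar>u\<bar>) powr \<alpha>\<close> and is
  bounded in \<open>s\<close>. Hence \<open>C\<close> does not depend on \<open>t\<close>.\<close>

lemma symbol_weight_uniform_bound:
  fixes c :: real
  assumes "c > 0"
  obtains C where "0 \<le> C" and "\<And>t u. 0 \<le> t \<Longrightarrow>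
    (1 + \<bar>u\<bar>) ^ m * ((1 + t * (1 + \<bar>u\<bar>) powr \<alpha>) ^ n * exp (- c * (t * (1 + \<bar>u\<bar>) powr \<alpha>)))
      / (1 + \<bar>u\<bar>) ^ (m + 2) \<le> C * inverse (1 + u\<^sup>2)"
proof -
  obtain C where C: "\<And>s::real. 0 \<le> s \<Longrightarrow> (1 + s) ^ n * exp (- c * s) \<le> C"
    using power_mult_exp_minus_bounded[OF assms] by blast
  have C0: "0 \<le> C" using C[of 0] by simp
  have "(1 + \<bar>u\<bar>) ^ m * ((1 + t * (1 + \<bar>u\<bar>) powr \<alpha>) ^ n * exp (- c * (t * (1 + \<bar>u\<bar>) powr \<alpha>)))
      / (1 + \<bar>u\<bar>) ^ (m + 2) \<le> C * inverse (1 + u\<^sup>2)" if "0 \<le> t" for t u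
  proof -
    let ?s = "t * (1 + \<bar>u\<bar>) powr \<alpha>"
    have "0 < (1 + \<bar>u\<bar>) ^ m" by (intro zero_less_power) linarith
    then have "(1 + \<bar>u\<bar>) ^ m * ((1 + ?s) ^ n * exp (- c * ?s)) / (1 + \<bar>u\<bar>) ^ (m + 2)
        = ((1 + ?s) ^ n * exp (- c * ?s)) * (1 / (1 + \<bar>u\<bar>)\<^sup>2)"
      by (simp only: power_add) (simp add: field_simps)
    also have "\<dots> \<le> C * inverse (1 + u\<^sup>2)"
      using that by (intro mult_mono C inverse_square_weight_le C0) auto
    finally show ?thesis .
  qed
  with C0 show thesis by (rule that)
qed

text \<open>For fixed \<open>t\<close> the exponential beats every power of
  \<open>1 + \<bar>u\<bar>\<close>. Here \<open>C\<close> may depend on \<open>t\<close>: the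
  estimate only has to justify integrability and the integrations by parts.\<close>

lemma symbol_weight_decay:
  fixes c :: real
  assumes "c > 0" and "t > 0" and \<alpha>: "\<alpha> > 0"
  obtains C where "0 \<le> C" and "\<And>k u.
    (1 + \<bar>u\<bar>) ^ m * ((1 + t * (1 + \<bar>u\<bar>) powr \<alpha>) ^ n * exp (- c * (t * (1 + \<bar>u\<bar>) powr \<alpha>)))
      / (1 + \<bar>u\<bar>) ^ k \<le> C * inverse (1 + u\<^sup>2)"
proof -
  \<comment> \<open>Chosen so that \<open>(1 + \<bar>u\<bar>) ^ (m + 2)\<close> is at most
    \<open>(s / t) ^ N\<close> with \<open>s = t (1 + \<bar>u\<bar>) powr \<alpha>\<close>; the
    constant therefore acquires the factor \<open>1 / t ^ N\<close>.\<close>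
  obtain N :: nat where "real (m + 2) / \<alpha> \<le> N"
    using real_arch_simple by blast
  then have N: "real (m + 2) \<le> \<alpha> * N" using \<alpha> by (simp add: pos_divide_le_eq mult.commute)
  obtain C where C: "\<And>s::real. 0 \<le> s \<Longrightarrow> (1 + s) ^ (N + n) * exp (- c * s) \<le> C"
    using power_mult_exp_minus_bounded[OF assms(1)] by blast
  have C0: "0 \<le> C" using C[of 0] by simp
  have "(1 + \<bar>u\<bar>) ^ m * ((1 + t * (1 + \<bar>u\<bar>) powr \<alpha>) ^ n * exp (- c * (t * (1 + \<bar>u\<bar>) powr \<alpha>)))
      / (1 + \<bar>u\<bar>) ^ k \<le> C / t ^ N * inverse (1 + u\<^sup>2)" for k u
  proof -
    let ?v = "1 + \<bar>u\<bar>"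
    let ?s = "t * ?v powr \<alpha>"
    let ?W = "(1 + ?s) ^ n * exp (- c * ?s)"
    have v: "1 \<le> ?v" "0 < ?v" by auto
    have s: "0 \<le> ?s" using assms(2) by simp
    have W: "0 \<le> ?W" using s by simp
    have "?v ^ (m + 2) = ?v powr real (m + 2)"
      using v powr_realpow[of ?v "m + 2"] by simp
    also have "\<dots> \<le> ?v powr (\<alpha> * N)"
      using v N by (intro powr_mono) auto
    also have "\<dots> = (?s / t) ^ N"
      using v assms(2) by (simp add: powr_powr[symmetric] powr_realpow)
    also have "\<dots> \<le> (1 + ?s) ^ N / t ^ N"
      unfolding power_divide using assms(2) s by (intro divide_right_mono power_mono) auto
    finally have pow: "?v ^ (m + 2) \<le> (1 + ?s) ^ N / t ^ N" .
    \<comment> \<open>The gain from differentiation is given away, which makes the constant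
      independent of \<open>k\<close>.\<close>
    have "?v ^ m * ?W / ?v ^ k \<le> ?v ^ m * ?W / 1"
    proof (rule divide_left_mono)
      show "1 \<le> ?v ^ k" using v(1) by (rule one_le_power)
      show "0 \<le> ?v ^ m * ?W" by (rule mult_nonneg_nonneg[OF zero_le_power[OF less_imp_le[OF v(2)]] W])
    qed (use v(2) in simp)
    also have "\<dots> = ?v ^ (m + 2) * ?W * (1 / ?v\<^sup>2)"
      using v(2) by (simp only: power_add) (simp add: field_simps)
    also have "\<dots> \<le> C / t ^ N * inverse (1 + u\<^sup>2)"
    proof (intro mult_mono inverse_square_weight_le)
      have "?v ^ (m + 2) * ?W \<le> (1 + ?s) ^ N / t ^ N * ?W"
        using pow W by (rule mult_right_mono)
      also have "\<dots> = (1 + ?s) ^ (N + n) * exp (- c * ?s) / t ^ N"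
        by (simp add: power_add)
      also have "\<dots> \<le> C / t ^ N"
        using C[OF s] assms(2) by (intro divide_right_mono) auto
      finally show "?v ^ (m + 2) * ?W \<le> C / t ^ N" .
    qed (use C0 assms(2) in auto)
    finally show ?thesis .
  qed
  moreover have "0 \<le> C / t ^ N" using C0 assms(2) by simp
  ultimately show thesis using that by blast
qed

text \<open>Integrating by parts \<open>m + 2\<close> times produces the factor
  \<open>\<bar>x\<bar> ^ (m + 2)\<close>. The orders up to \<open>m + 2\<close> need quadratic decay
  for each \<open>t\<close> separately; the estimate uniform in \<open>t\<close> is needed only at
  order \<open>m + 2\<close>.\<close>

lemma fourier_integral_symbol_bound:
  fixes \<phi> :: "real \<Rightarrow> real \<Rightarrow> complex" and m :: nat
  assumes I: "I \<subseteq> {0<..}" and c: "c > 0" and \<alpha>: "\<alpha> > 0"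
    and \<phi>: "\<And>n. symbol_bound n I
      (\<lambda>t u. (1 + t * (1 + \<bar>u\<bar>) powr \<alpha>) ^ n * exp (- c * (t * (1 + \<bar>u\<bar>) powr \<alpha>))) \<phi>"
  shows "\<And>t. t \<in> I \<Longrightarrow> integrable lborel (\<lambda>u. (- \<i> * of_real u) ^ m * \<phi> t u)"
    and "\<exists>C. \<forall>t\<in>I. \<forall>x. \<bar>x\<bar> ^ (m + 2) *
      norm (\<integral>u. iexp (- (u * x)) * ((- \<i> * of_real u) ^ m * \<phi> t u) \<partial>lborel) \<le> C"
proof -
  let ?n = "m + 2"
  let ?w = "\<lambda>t u. (1 + \<bar>u\<bar>) ^ m * ((1 + t * (1 + \<bar>u\<bar>) powr \<alpha>) ^ ?n * exp (- c * (t * (1 + \<bar>u\<bar>) powr \<alpha>)))"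
  define f where "f t u = (- \<i> * of_real u) ^ m * \<phi> t u" for t u
  have f: "symbol_bound ?n I ?w f"
    using symbol_bound_mult[OF symbol_bound_power[OF symbol_bound_linear[of ?n I "- \<i>"], of m] \<phi>[of ?n]]
    by (simp add: f_def[abs_def])
  have decay: "\<exists>B. \<forall>u. norm (nth_derivative k (f t) u) \<le> B * inverse (1 + u\<^sup>2)"
    if t: "t \<in> I" and k: "k \<le> ?n" for t k
  proof -
    obtain C where C: "\<And>t u. t \<in> I \<Longrightarrow> norm (nth_derivative k (f t) u) \<le> C * (?w t u / (1 + \<bar>u\<bar>) ^ k)"
      by (rule symbol_bound_norm[OF f k], rule that)
    have "0 < t" using I t by auto
    then obtain D where "0 \<le> D" and D: "\<And>u. ?w t u / (1 + \<bar>u\<bar>) ^ k \<le> D * inverse (1 + u\<^sup>2)"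
      using symbol_weight_decay[OF c _ \<alpha>, of t m ?n] by metis
    have "norm (nth_derivative k (f t) u) \<le> (\<bar>C\<bar> * D) * inverse (1 + u\<^sup>2)" for u
    proof -
      have "C * (?w t u / (1 + \<bar>u\<bar>) ^ k) \<le> \<bar>C\<bar> * (D * inverse (1 + u\<^sup>2))"
        using D[of u] \<open>0 < t\<close> by (intro mult_mono) (auto intro!: divide_nonneg_nonneg mult_nonneg_nonneg)
      then show ?thesis using C[OF t, of u] by simp
    qed
    then show ?thesis by blast
  qed
  have f_diff: "nth_derivative k (f t) differentiable (at u)" if "t \<in> I" "k \<le> ?n" for k t u
    using symbol_bound_differentiable[OF f] that by blast
  have int: "integrable lborel (nth_derivative k (f t))" if t: "t \<in> I" and k: "k \<le> ?n" for t k
  proof -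
    obtain B where "\<And>u. norm (nth_derivative k (f t) u) \<le> B * inverse (1 + u\<^sup>2)"
      using decay[OF t k] by blast
    moreover have "continuous_on UNIV (nth_derivative k (f t))"
      using f_diff[OF t k] by (simp add: continuous_on_eq_continuous_at differentiable_imp_continuous_within)
    ultimately show ?thesis
      by (intro integrable_quadratic_decay[of _ B] borel_measurable_continuous_onI)
  qed
  show "integrable lborel (\<lambda>u. (- \<i> * of_real u) ^ m * \<phi> t u)" if "t \<in> I" for t
    using int[OF that, of 0] by (simp add: f_def[abs_def])
  obtain C where C: "\<And>t u. t \<in> I \<Longrightarrow> norm (nth_derivative ?n (f t) u) \<le> C * (?w t u / (1 + \<bar>u\<bar>) ^ ?n)"
    by (rule symbol_bound_norm[OF f order_refl], rule that)
  obtain D where "0 \<le> D" and D: "\<And>t u. 0 \<le> t \<Longrightarrow> ?w t u / (1 + \<bar>u\<bar>) ^ ?n \<le> D * inverse (1 + u\<^sup>2)"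
    using symbol_weight_uniform_bound[OF c, of m \<alpha> ?n] by metis
  have "\<bar>x\<bar> ^ ?n * norm (\<integral>u. iexp (- (u * x)) * f t u \<partial>lborel)
      \<le> (\<integral>u. (\<bar>C\<bar> * D) * inverse (1 + u\<^sup>2) \<partial>lborel)" if t: "t \<in> I" for t x
  proof -
    have bound: "norm (nth_derivative ?n (f t) u) \<le> (\<bar>C\<bar> * D) * inverse (1 + u\<^sup>2)" for u
    proof -
      have "0 < t" using I t by auto
      then have "C * (?w t u / (1 + \<bar>u\<bar>) ^ ?n) \<le> \<bar>C\<bar> * (D * inverse (1 + u\<^sup>2))"
        using D[of t u] by (intro mult_mono) (auto intro!: divide_nonneg_nonneg mult_nonneg_nonneg)
      then show ?thesis using C[OF t, of u] by simp
    qed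
    have "\<bar>x\<bar> ^ ?n * norm (\<integral>u. iexp (- (u * x)) * f t u \<partial>lborel)
        = norm ((\<i> * of_real x) ^ ?n * (\<integral>u. iexp (- (u * x)) * f t u \<partial>lborel))"
      by (simp only: norm_mult norm_power norm_ii norm_of_real mult_1)
    also have "\<dots> = norm (\<integral>u. iexp (- (u * x)) * nth_derivative ?n (f t) u \<partial>lborel)"
      using f_diff[OF t] decay[OF t] by (subst fourier_integral_nth_derivative) auto
    also have "\<dots> \<le> (\<integral>u. norm (iexp (- (u * x)) * nth_derivative ?n (f t) u) \<partial>lborel)"
      by (rule integral_norm_bound)
    also have "\<dots> = (\<integral>u. norm (nth_derivative ?n (f t) u) \<partial>lborel)"
      by (simp add: norm_mult)
    also have "\<dots> \<le> (\<integral>u. (\<bar>C\<bar> * D) * inverse (1 + u\<^sup>2) \<partial>lborel)"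
      by (intro integral_mono integrable_norm int[OF t] integrable_mult_right
          integrable_inverse_1_plus_square_lborel order_refl bound)
    finally show ?thesis .
  qed
  then show "\<exists>C. \<forall>t\<in>I. \<forall>x. \<bar>x\<bar> ^ (m + 2) *
      norm (\<integral>u. iexp (- (u * x)) * ((- \<i> * of_real u) ^ m * \<phi> t u) \<partial>lborel) \<le> C"
    unfolding f_def by blast
qed

text \<open>For large \<open>\<bar>u\<bar>\<close>, \<open>(1 + \<bar>u\<bar>) powr \<alpha> \<le>
  (2 * \<bar>u\<bar>) powr \<alpha> \<le> 4 * \<bar>u\<bar> powr \<alpha>\<close> since \<alpha>
  \<le> 2, which explains \<open>c / 4\<close>. For small \<open>\<bar>u\<bar>\<close> the left side
  is at most 1, and \<open>K\<close> offsets the least value of the exponential, using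
  \<open>t \<le> t\<^sub>0\<close>.\<close>

lemma norm_exp_exponent_le:
  fixes \<gamma> :: "real \<Rightarrow> complex"
  assumes nonpos: "\<And>u. Re (\<gamma> u) \<le> 0"
    and decay: "\<And>u. \<bar>u\<bar> > u\<^sub>0 \<Longrightarrow> Re (\<gamma> u) \<le> - c * \<bar>u\<bar> powr \<alpha>"
    and c: "c > 0" and \<alpha>: "0 < \<alpha>" "\<alpha> \<le> 2"
  obtains K where "\<And>t u. t \<in> {0<..t\<^sub>0} \<Longrightarrow>
    norm (exp (of_real t * \<gamma> u)) \<le> K * exp (- (c / 4) * (t * (1 + \<bar>u\<bar>) powr \<alpha>))"
proof -
  define R where "R = max u\<^sub>0 1"
  define K where "K = exp ((c / 4) * (t\<^sub>0 * (1 + R) powr \<alpha>))"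
  have "norm (exp (of_real t * \<gamma> u)) \<le> K * exp (- (c / 4) * (t * (1 + \<bar>u\<bar>) powr \<alpha>))"
    if t: "t \<in> {0<..t\<^sub>0}" for t u
  proof (cases "\<bar>u\<bar> \<le> R")
    case True
    then have "t * (1 + \<bar>u\<bar>) powr \<alpha> \<le> t\<^sub>0 * (1 + R) powr \<alpha>"
      using t \<alpha> by (intro mult_mono powr_mono2) auto
    then have "(c / 4) * (t * (1 + \<bar>u\<bar>) powr \<alpha>) \<le> (c / 4) * (t\<^sub>0 * (1 + R) powr \<alpha>)"
      using c by (intro mult_left_mono) auto
    then have "1 \<le> K * exp (- (c / 4) * (t * (1 + \<bar>u\<bar>) powr \<alpha>))"
      unfolding K_def by (simp flip: exp_add)
    moreover have "norm (exp (of_real t * \<gamma> u)) \<le> 1"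
      using t nonpos[of u] by (simp add: mult_nonneg_nonpos)
    ultimately show ?thesis by linarith
  next
    case False
    then have u: "\<bar>u\<bar> > u\<^sub>0" "\<bar>u\<bar> > 1" by (auto simp: R_def)
    have "(1 + \<bar>u\<bar>) powr \<alpha> \<le> (2 * \<bar>u\<bar>) powr \<alpha>"
      using u \<alpha> by (intro powr_mono2) auto
    also have "\<dots> = 2 powr \<alpha> * \<bar>u\<bar> powr \<alpha>"
      by (simp add: powr_mult)
    also have "\<dots> \<le> 2 powr 2 * \<bar>u\<bar> powr \<alpha>"
      using \<alpha> by (intro mult_right_mono powr_mono) auto
    finally have "(1 + \<bar>u\<bar>) powr \<alpha> \<le> 4 * \<bar>u\<bar> powr \<alpha>" by simp
    then have "(c / 4) * (1 + \<bar>u\<bar>) powr \<alpha> \<le> (c / 4) * (4 * \<bar>u\<bar> powr \<alpha>)"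
      using c by (intro mult_left_mono) auto
    then have "Re (\<gamma> u) \<le> - ((c / 4) * (1 + \<bar>u\<bar>) powr \<alpha>)"
      using decay[OF u(1)] by simp
    then have "t * Re (\<gamma> u) \<le> t * - ((c / 4) * (1 + \<bar>u\<bar>) powr \<alpha>)"
      using t by (intro mult_left_mono) auto
    then have "norm (exp (of_real t * \<gamma> u)) \<le> 1 * exp (- (c / 4) * (t * (1 + \<bar>u\<bar>) powr \<alpha>))"
      by (simp add: mult_ac)
    also have "\<dots> \<le> K * exp (- (c / 4) * (t * (1 + \<bar>u\<bar>) powr \<alpha>))"
      using t c unfolding K_def by (intro mult_right_mono) auto
    finally show ?thesis .
  qed
  then show thesis by (rule that)
qed

theorem proposition7p3:
  fixes M :: "'a measure" and X :: "real \<Rightarrow> 'a \<Rightarrow> real"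
    and \<gamma> :: "real \<Rightarrow> complex" and p :: "real \<Rightarrow> real \<Rightarrow> real"
    and \<alpha> \<epsilon> t\<^sub>0 :: real and m :: nat
  assumes levy: "levy_process M X"
    and psi_smooth: "smooth (characteristic_function M X 1)"
    and psi_integrable:
      "\<And>r k. integrable lborel (\<lambda>u. \<bar>u\<bar> ^ k * norm (nth_derivative r (characteristic_function M X 1) u))"
    and gamma_continuous: "continuous_on UNIV \<gamma>"
    and gamma_zero: "\<gamma> 0 = 0"
    and gamma_exponent: "\<And>t u. t \<ge> 0 \<Longrightarrow> characteristic_function M X t u = exp (of_real t * \<gamma> u)"
    and density: "\<And>t. t > 0 \<Longrightarrow> continuous_density M (X t) (p t)"
    and alpha: "0 < \<alpha>" "\<alpha> \<le> 2"
    and gamma_bound: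
      "\<And>i. i \<ge> 1 \<Longrightarrow> \<exists>c u\<^sub>0. u\<^sub>0 > 0 \<and>
        (\<forall>u. \<bar>u\<bar> > u\<^sub>0 \<longrightarrow> norm (nth_derivative i \<gamma> u) \<le> c * \<bar>u\<bar> powr (\<alpha> - real i))"
    and psi_bound:
      "\<exists>u\<^sub>0 c\<^sub>0. u\<^sub>0 > 0 \<and> c\<^sub>0 > 0 \<and>
        (\<forall>u. u > u\<^sub>0 \<longrightarrow> norm (characteristic_function M X 1 u) \<le> exp (- c\<^sub>0 * \<bar>u\<bar> powr \<alpha>))"
    and eps: "\<epsilon> > 0"
    and t0: "t\<^sub>0 > 0"
  shows "(SUP t\<in>{0<..t\<^sub>0}. SUP x\<in>{x. \<bar>x\<bar> > \<epsilon>}. ereal \<bar>nth_derivative m (p t) x\<bar>) < \<infinity>"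
proof -
  interpret levy_process M X by (rule levy)
  let ?I = "{0<..t\<^sub>0}"
  define \<phi> where "\<phi> t u = exp (of_real t * \<gamma> u)" for t u
  have char: "char (distr M borel (X t)) = \<phi> t" if "t \<ge> 0" for t
    using gamma_exponent[OF that] by (auto simp: \<phi>_def characteristic_function_def)
  have psi: "characteristic_function M X 1 = (\<lambda>u. exp (\<gamma> u))"
    using gamma_exponent[of 1] by auto
  interpret D: real_distribution "distr M borel (X 1)"
    using random_variable[of 1] by (simp add: real_distribution_def real_distribution_axioms_def prob_space_distr)
  have norm_psi: "norm (char (distr M borel (X 1)) u) = exp (Re (\<gamma> u))" for u
    using char[of 1] by (simp add: \<phi>_def)
  obtain u0 c where u0: "u0 > 0" and c: "c > 0"
    and psi_decay: "\<And>u. u > u0 \<Longrightarrow> exp (Re (\<gamma> u)) \<le> exp (- c * \<bar>u\<bar> powr \<alpha>)"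
    using psi_bound unfolding psi by auto
  \<comment> \<open>Condition (2) is given for positive \<open>u\<close> only; as \<open>X 1\<close>
    is real-valued, it passes to negative \<open>u\<close>.\<close>
  have Re_even: "Re (\<gamma> (- u)) = Re (\<gamma> u)" for u
  proof -
    have "exp (Re (\<gamma> (- u))) = exp (Re (\<gamma> u))"
      unfolding norm_psi[symmetric] D.char_minus by (rule complex_mod_cnj)
    then show ?thesis by simp
  qed
  have Re_decay: "Re (\<gamma> u) \<le> - c * \<bar>u\<bar> powr \<alpha>" if "\<bar>u\<bar> > u0" for u
    using psi_decay[of "\<bar>u\<bar>"] that Re_even[of u] by (auto simp: abs_if split: if_splits)
  have Re_nonpos: "Re (\<gamma> u) \<le> 0" for u
    using D.cmod_char_le_1[of u] unfolding norm_psi by simp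
  obtain K where K: "\<And>t u. t \<in> ?I \<Longrightarrow> 
      norm (exp (of_real t * \<gamma> u)) \<le> K * exp (- (c / 4) * (t * (1 + \<bar>u\<bar>) powr \<alpha>))"
    by (rule norm_exp_exponent_le[OF Re_nonpos Re_decay c alpha, where t\<^sub>0 = t\<^sub>0], assumption, rule that)
  have smooth: "smooth \<gamma>"
    using smooth_exp_lift[OF gamma_continuous] psi_smooth psi by simp
  let ?\<gamma>' = "nth_derivative (Suc 0) \<gamma>"
  have d\<gamma>: "(\<gamma> has_vector_derivative ?\<gamma>' u) (at u)" for u
    using smooth unfolding smooth_def nth_derivative_Suc
    by (metis nth_derivative_0 vector_derivative_works)
  \<comment> \<open>The \<open>k\<close>-th derivative of \<gamma>' is the derivative of \<gamma> of
    order \<open>k + 1\<close>, so condition (1) is used exactly for \<open>i \<ge> 1\<close>;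
    smoothness of \<gamma> supplies the continuity needed for small \<open>u\<close>.\<close>
  have "symbol_bound n ?I (\<lambda>t u. (1 + \<bar>u\<bar>) powr \<alpha> / (1 + \<bar>u\<bar>)) (\<lambda>_. ?\<gamma>')" for n
    unfolding symbol_bound_def nth_derivative_Suc_inner[OF d\<gamma>, symmetric]
  proof (intro allI impI conjI ballI)
    fix k
    show "nth_derivative (Suc k) \<gamma> differentiable (at u)" for u
      using smooth by (simp add: smooth_def)
    then have cont: "continuous_on UNIV (nth_derivative (Suc k) \<gamma>)"
      by (simp add: continuous_on_eq_continuous_at differentiable_imp_continuous_within)
    obtain b R where decay: "\<And>u. \<bar>u\<bar> > R \<Longrightarrow>
        norm (nth_derivative (Suc k) \<gamma> u) \<le> b * \<bar>u\<bar> powr (\<alpha> - real (Suc k))"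
      using gamma_bound[of "Suc k"] by auto
    obtain C where
      "\<And>u. norm (nth_derivative (Suc k) \<gamma> u) \<le> C * ((1 + \<bar>u\<bar>) powr \<alpha> / (1 + \<bar>u\<bar>) ^ Suc k)"
      by (rule powr_decay_imp_weight_bound[OF cont decay less_imp_le[OF alpha(1)]], assumption, rule that)
    then show "\<exists>C. \<forall>t\<in>?I. \<forall>u. norm (nth_derivative (Suc k) \<gamma> u)
        \<le> C * ((1 + \<bar>u\<bar>) powr \<alpha> / (1 + \<bar>u\<bar>) / (1 + \<bar>u\<bar>) ^ k)"
      by auto
  qed
  \<comment> \<open>Instance of \<open>symbol_bound_exp\<close> with
    \<open>a u = (1 + \<bar>u\<bar>) powr \<alpha>\<close> and
    \<open>e t u = exp (- (c / 4) * (t * a u))\<close>.\<close>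
  then have \<phi>: "symbol_bound n ?I
      (\<lambda>t u. (1 + t * (1 + \<bar>u\<bar>) powr \<alpha>) ^ n * exp (- (c / 4) * (t * (1 + \<bar>u\<bar>) powr \<alpha>))) \<phi>" for n
    using K unfolding \<phi>_def[abs_def] by (intro symbol_bound_exp[OF _ _ _ d\<gamma>]) auto
  have c4: "0 < c / 4" and I: "?I \<subseteq> {0<..}" using c by auto
  \<comment> \<open>The \<open>k\<close>-th derivative of the inversion formula, taken under the
    integral. It is complex-valued by form; real parts link it to the real density.\<close>
  define q where "q t k x = (\<integral>u. iexp (- (u * x)) * ((- \<i> * of_real u) ^ k * \<phi> t u) \<partial>lborel) / (2 * pi)" for t k x
  have deriv: "nth_derivative m (p t) x = Re (q t m x)" if t: "t \<in> ?I" for t x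
  proof -
    note int = fourier_integral_symbol_bound(1)[OF I c4 alpha(1) \<phi> t]
    have "t > 0" using t by simp
    have "nth_derivative m (p t) = (\<lambda>x. Re (q t m x))"
    proof (rule nth_derivative_unique)
      have eq: "q t 0 x = complex_of_real (p t x)" for x
        using fourier_inversion[OF density[OF \<open>t > 0\<close>]] int[of 0] char[of t] \<open>t > 0\<close>
        by (simp add: q_def)
      show "(\<lambda>x. Re (q t 0 x)) = p t"
        by (simp add: eq)
    next
      fix k x
      have "((\<lambda>x. \<integral>u. iexp (- (u * x)) * ((- \<i> * of_real u) ^ k * \<phi> t u) \<partial>lborel) has_vector_derivative
          (\<integral>u. iexp (- (u * x)) * (- \<i> * of_real u * ((- \<i> * of_real u) ^ k * \<phi> t u)) \<partial>lborel)) (at x)"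
        using int[of k] int[of "Suc k"]
        by (intro fourier_integral_has_derivative) (simp_all only: power_Suc mult.assoc)
      then have "(q t k has_vector_derivative q t (Suc k) x) (at x)"
        unfolding q_def power_Suc mult.assoc by (rule has_vector_derivative_divide)
      then show "((\<lambda>x. Re (q t k x)) has_vector_derivative Re (q t (Suc k) x)) (at x)"
        by (rule bounded_linear.has_vector_derivative[OF bounded_linear_Re])
    qed
    then show ?thesis by simp
  qed
  obtain C where C: "\<And>t x. t \<in> ?I \<Longrightarrow> \<bar>x\<bar> ^ (m + 2) *
      norm (\<integral>u. iexp (- (u * x)) * ((- \<i> * of_real u) ^ m * \<phi> t u) \<partial>lborel) \<le> C"
    using fourier_integral_symbol_bound(2)[OF I c4 alpha(1) \<phi>, of m] by blast
  have "\<bar>nth_derivative m (p t) x\<bar> \<le> C / \<epsilon> ^ (m + 2)" if t: "t \<in> ?I" and x: "\<bar>x\<bar> > \<epsilon>" for t x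
  proof -
    let ?J = "\<integral>u. iexp (- (u * x)) * ((- \<i> * of_real u) ^ m * \<phi> t u) \<partial>lborel"
    \<comment> \<open>Staying away from the origin turns the bound on
      \<open>\<bar>x\<bar> ^ (m + 2) * norm ?J\<close> into one on \<open>norm ?J\<close> with a
      constant free of \<open>t\<close> and \<open>x\<close>.\<close>
    have "\<epsilon> ^ (m + 2) * norm ?J \<le> \<bar>x\<bar> ^ (m + 2) * norm ?J"
      using x eps by (intro mult_right_mono power_mono) auto
    then have J: "norm ?J \<le> C / \<epsilon> ^ (m + 2)"
      using C[OF t, of x] eps by (simp only: pos_le_divide_eq zero_less_power mult.commute)
    have "\<bar>nth_derivative m (p t) x\<bar> \<le> norm (q t m x)"
      unfolding deriv[OF t] by (rule abs_Re_le_cmod)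
    also have "\<dots> = norm ?J / (2 * pi)"
      by (simp add: q_def norm_divide norm_mult)
    also have "\<dots> \<le> norm ?J / 1"
      using pi_gt3 by (intro divide_left_mono) auto
    finally show ?thesis using J by simp
  qed
  then have "(SUP t\<in>?I. SUP x\<in>{x. \<bar>x\<bar> > \<epsilon>}. ereal \<bar>nth_derivative m (p t) x\<bar>) \<le> ereal (C / \<epsilon> ^ (m + 2))"
    by (intro SUP_least) auto
  then show ?thesis by (rule order.strict_trans1) simp
qed

end
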